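(* Let $\mathcal P$ be a set of probability distributions, let $\Theta$ be a set (the parameter space), and let $\theta^\star:\mathcal P\to\Theta$ be the estimand. For each $n\ge 1$ let $(\mathcal H_n(\alpha))_{\alpha>0}$ be a family of random subsets of $\Theta$ which is monotonic and right-continuous in $\alpha$, meaning: (a) (monotonicity) $\mathcal H_n(\alpha_2)\subseteq \mathcal H_n(\alpha_1)$ for all $0<\alpha_1<\alpha_2$; (b) (right-continuity) for every $\theta\in\Theta$, the rejection set $\{\alpha>0:\theta\notin\mathcal H_n(\alpha)\}$ is a left-closed interval of the form $[\alpha_0,\infty)$ for some $\alpha_0>0$. Then the sequence $(\mathcal H_n)_{n\ge1}$ is an asymptotic post-hoc confidence interval (respectively, a $\mathcal P$-uniform asymptotic post-hoc confidence interval) for $\theta^\star$ under $\mathcal P$ if and only if there exists, for each $\theta\in\Theta$, a sequence of random variables $(E_n(\theta))_{n\ge1}$ such that for all $n\geq 1$ and all $\alpha>0$, $$\mathcal H_n(\alpha)=\{\theta\in\Theta: E_n(\theta)<1/\alpha\},$$ and such that $(E_n(\theta^\star))_{n\ge1}$ is an asymptotic e-variable (respectively, a $\mathcal P$-uniform asymptotic e-variable). Furthermore, a sequence of nonnegative random variables $(Q_n)_{n\ge1}$ is an asymptotic post-hoc p-value (respectively, a $\mathcal P$-uniform asymptotic post-hoc p-value) for $\mathcal P$ if and only if there exists an asymptotic e-variable (respectively, a $\mathcal P$-uniform asymptotic e-variable) $(E_n)_{n\ge1}$ for $\mathcal P$ such that $Q_n=1/E_n$ for every $n$.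
   Context: All random objects live on a measurable space $(\Omega,\mathcal F)$, and each $P\in\mathcal P$ is a probability measure on it, with expectation $\mathbb E_P$. That $\mathcal H_n(\alpha)$ is a random subset of $\Theta$ means that $\{\theta\notin\mathcal H_n(\alpha)\}$ is an event for every $\theta$; properties (a) and (b) hold for every realization. Risks: for a family of random sets $\mathcal H_n=\{\mathcal H_n(\alpha)\}_{\alpha>0}$, $\mathbf R(\mathcal H_n;\theta^\star,P)=\mathbb E_P\big[\sup_{\alpha>0}\mathbf 1\{\theta^\star(P)\notin\mathcal H_n(\alpha)\}/\alpha\big]$. For a nonnegative random variable $Q$, $\mathbf S(Q;P)=\mathbb E_P\big[\sup_{\alpha>0}\mathbf 1\{Q\le\alpha\}/\alpha\big]$. $(\mathcal H_n)$ is an asymptotic post-hoc confidence interval for $\theta^\star$ under $\mathcal P$ if $\sup_{P\in\mathcal P}\limsup_{n\to\infty}\mathbf R(\mathcal H_n;\theta^\star,P)\le1$, and a $\mathcal P$-uniform one if $\limsup_{n\to\infty}\sup_{P\in\mathcal P}\mathbf R(\mathcal H_n;\theta^\star,P)\le1$. $(Q_n)$ is an asymptotic post-hoc p-value for $\mathcal P$ if $\sup_{P\in\mathcal P}\limsup_{n\to\infty}\mathbf S(Q_n;P)\le1$, and a $\mathcal P$-uniform one if $\limsup_{n\to\infty}\sup_{P\in\mathcal P}\mathbf S(Q_n;P)\le1$. A sequence of nonnegative (possibly $+\infty$-valued) random variables $(E_n)$ is an asymptotic e-variable for $\mathcal P$ if $\sup_{P\in\mathcal P}\limsup_{n\to\infty}\mathbb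 E_P[E_n]\le1$, and a $\mathcal P$-uniform asymptotic e-variable if $\limsup_{n\to\infty}\sup_{P\in\mathcal P}\mathbb E_P[E_n]\le1$. For $(E_n(\theta^\star))$, the expectation under $P$ is that of $E_n(\theta^\star(P))$. Conventions: $1/0=\infty$, $1/\infty=0$. *)

theory Defs
  imports "HOL-Probability.Probability"
begin

text \<open>
  The measurable space of events is represented by a measure \<^term>\<open>M\<close> of which only
  \<^term>\<open>space M\<close> and \<^term>\<open>sets M\<close> matter; distributions are probability measures \<open>P\<close>
  with \<open>sets P = sets M\<close>. Extended nonnegative random variables are \<^typ>\<open>ennreal\<close>-valued,
  where \<open>1 / 0 = \<infinity>\<close> and \<open>1 / \<infinity> = 0\<close>. Sequences are indexed by \<open>n \<ge> 1\<close>; their values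
  at \<open>0\<close> are irrelevant. For a family of random sets, \<open>H n \<alpha> \<omega>\<close> is the realization at \<open>\<omega>\<close>
  of the \<open>n\<close>-th set at level \<open>\<alpha>\<close>, relevant only for \<open>\<alpha> > 0\<close>.
\<close>

definition random_subset :: "'a measure \<Rightarrow> 'b set \<Rightarrow> ('a \<Rightarrow> 'b set) \<Rightarrow> bool" where
  "random_subset M \<Theta> S \<longleftrightarrow>
     (\<forall>\<omega>\<in>space M. S \<omega> \<subseteq> \<Theta>) \<and> (\<forall>\<theta>\<in>\<Theta>. {\<omega> \<in> space M. \<theta> \<notin> S \<omega>} \<in> sets M)"

definition level_monotonic :: "'a measure \<Rightarrow> (real \<Rightarrow> 'a \<Rightarrow> 'b set) \<Rightarrow> bool" where
  "level_monotonic M H \<longleftrightarrow>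
     (\<forall>\<omega>\<in>space M. \<forall>\<alpha>\<^sub>1 \<alpha>\<^sub>2. 0 < \<alpha>\<^sub>1 \<longrightarrow> \<alpha>\<^sub>1 < \<alpha>\<^sub>2 \<longrightarrow> H \<alpha>\<^sub>2 \<omega> \<subseteq> H \<alpha>\<^sub>1 \<omega>)"

definition level_right_continuous ::
    "'a measure \<Rightarrow> 'b set \<Rightarrow> (real \<Rightarrow> 'a \<Rightarrow> 'b set) \<Rightarrow> bool" where
  "level_right_continuous M \<Theta> H \<longleftrightarrow>
     (\<forall>\<omega>\<in>space M. \<forall>\<theta>\<in>\<Theta>. \<exists>\<alpha>\<^sub>0>0. {\<alpha>. 0 < \<alpha> \<and> \<theta> \<notin> H \<alpha> \<omega>} = {\<alpha>\<^sub>0..})"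

text \<open>In the risks, \<open>\<alpha>\<close> ranges over the positive reals and the supremum is taken in
  \<^typ>\<open>ennreal\<close>.\<close>

definition confidence_risk ::
    "(real \<Rightarrow> 'a \<Rightarrow> 'b set) \<Rightarrow> ('a measure \<Rightarrow> 'b) \<Rightarrow> 'a measure \<Rightarrow> ennreal" where
  "confidence_risk H \<theta>s P =
     (\<integral>\<^sup>+\<omega>. (SUP \<alpha>\<in>{0<..}. of_bool (\<theta>s P \<notin> H \<alpha> \<omega>) / ennreal \<alpha>) \<partial>P)"

definition p_value_risk :: "('a \<Rightarrow> ennreal) \<Rightarrow> 'a measure \<Rightarrow> ennreal" where
  "p_value_risk Q P =
     (\<integral>\<^sup>+\<omega>. (SUP \<alpha>\<in>{0<..}. of_bool (Q \<omega> \<le> ennreal \<alpha>) / ennreal \<alpha>) \<partial>P)"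

definition asymp_post_hoc_ci ::
    "'a measure set \<Rightarrow> ('a measure \<Rightarrow> 'b) \<Rightarrow> (nat \<Rightarrow> real \<Rightarrow> 'a \<Rightarrow> 'b set) \<Rightarrow> bool" where
  "asymp_post_hoc_ci \<P> \<theta>s H \<longleftrightarrow>
     (SUP P\<in>\<P>. limsup (\<lambda>n. confidence_risk (H n) \<theta>s P)) \<le> 1"

definition unif_asymp_post_hoc_ci ::
    "'a measure set \<Rightarrow> ('a measure \<Rightarrow> 'b) \<Rightarrow> (nat \<Rightarrow> real \<Rightarrow> 'a \<Rightarrow> 'b set) \<Rightarrow> bool" where
  "unif_asymp_post_hoc_ci \<P> \<theta>s H \<longleftrightarrow>
     limsup (\<lambda>n. SUP P\<in>\<P>. confidence_risk (H n) \<theta>s P) \<le> 1"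

definition asymp_post_hoc_p_value ::
    "'a measure set \<Rightarrow> (nat \<Rightarrow> 'a \<Rightarrow> ennreal) \<Rightarrow> bool" where
  "asymp_post_hoc_p_value \<P> Q \<longleftrightarrow> (SUP P\<in>\<P>. limsup (\<lambda>n. p_value_risk (Q n) P)) \<le> 1"

definition unif_asymp_post_hoc_p_value ::
    "'a measure set \<Rightarrow> (nat \<Rightarrow> 'a \<Rightarrow> ennreal) \<Rightarrow> bool" where
  "unif_asymp_post_hoc_p_value \<P> Q \<longleftrightarrow> limsup (\<lambda>n. SUP P\<in>\<P>. p_value_risk (Q n) P) \<le> 1"

definition asymp_e_variable ::
    "'a measure \<Rightarrow> 'a measure set \<Rightarrow> (nat \<Rightarrow> 'a \<Rightarrow> ennreal) \<Rightarrow> bool" where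
  "asymp_e_variable M \<P> E \<longleftrightarrow>
     (\<forall>n\<ge>1. E n \<in> borel_measurable M) \<and>
     (SUP P\<in>\<P>. limsup (\<lambda>n. \<integral>\<^sup>+\<omega>. E n \<omega> \<partial>P)) \<le> 1"

definition unif_asymp_e_variable ::
    "'a measure \<Rightarrow> 'a measure set \<Rightarrow> (nat \<Rightarrow> 'a \<Rightarrow> ennreal) \<Rightarrow> bool" where
  "unif_asymp_e_variable M \<P> E \<longleftrightarrow>
     (\<forall>n\<ge>1. E n \<in> borel_measurable M) \<and>
     limsup (\<lambda>n. SUP P\<in>\<P>. \<integral>\<^sup>+\<omega>. E n \<omega> \<partial>P) \<le> 1"

text \<open>The same notions for a family \<open>E n \<theta>\<close> evaluated at the estimand: the variable whose
  expectation is taken under \<open>P\<close> is \<open>E n (\<theta>s P)\<close>.\<close>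

definition asymp_e_variable_at ::
    "'a measure \<Rightarrow> 'a measure set \<Rightarrow> ('a measure \<Rightarrow> 'b) \<Rightarrow> (nat \<Rightarrow> 'b \<Rightarrow> 'a \<Rightarrow> ennreal) \<Rightarrow> bool" where
  "asymp_e_variable_at M \<P> \<theta>s E \<longleftrightarrow>
     (\<forall>n\<ge>1. \<forall>P\<in>\<P>. E n (\<theta>s P) \<in> borel_measurable M) \<and>
     (SUP P\<in>\<P>. limsup (\<lambda>n. \<integral>\<^sup>+\<omega>. E n (\<theta>s P) \<omega> \<partial>P)) \<le> 1"

definition unif_asymp_e_variable_at ::
    "'a measure \<Rightarrow> 'a measure set \<Rightarrow> ('a measure \<Rightarrow> 'b) \<Rightarrow> (nat \<Rightarrow> 'b \<Rightarrow> 'a \<Rightarrow> ennreal) \<Rightarrow> bool" where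
  "unif_asymp_e_variable_at M \<P> \<theta>s E \<longleftrightarrow>
     (\<forall>n\<ge>1. \<forall>P\<in>\<P>. E n (\<theta>s P) \<in> borel_measurable M) \<and>
     limsup (\<lambda>n. SUP P\<in>\<P>. \<integral>\<^sup>+\<omega>. E n (\<theta>s P) \<omega> \<partial>P) \<le> 1"

definition level_set_representation ::
    "'a measure \<Rightarrow> 'b set \<Rightarrow> (nat \<Rightarrow> real \<Rightarrow> 'a \<Rightarrow> 'b set) \<Rightarrow> (nat \<Rightarrow> 'b \<Rightarrow> 'a \<Rightarrow> ennreal) \<Rightarrow> bool" where
  "level_set_representation M \<Theta> H E \<longleftrightarrow>
     (\<forall>n\<ge>1. \<forall>\<alpha>>0. \<forall>\<omega>\<in>space M. H n \<alpha> \<omega> = {\<theta>\<in>\<Theta>. E n \<theta> \<omega> < 1 / ennreal \<alpha>})"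

end

theory Submission
  imports Defs
begin

text \<open>
  Everything rests on one identity in \<open>[0, \<infinity>]\<close>: the supremum of \<open>1 / \<alpha>\<close> over the levels
  \<open>\<alpha> > 0\<close> with \<open>1 / \<alpha> \<le> x\<close> is \<open>x\<close> itself (\<open>SUP_reject_levels\<close>). It makes the risks
  expectations, without any loss. If \<open>H \<alpha> = {\<theta>. E \<theta> < 1 / \<alpha>}\<close>, then \<open>\<theta>\<close> is rejected at level
  \<open>\<alpha>\<close> exactly when \<open>1 / \<alpha> \<le> E \<theta>\<close>, so the integrand of the confidence risk is \<open>E (\<theta>s P)\<close>;
  likewise \<open>Q \<le> \<alpha>\<close> exactly when \<open>1 / \<alpha> \<le> 1 / Q\<close>, so the integrand of the p-value risk is
  \<open>1 / Q\<close>. The asymptotic requirements on the two sides are therefore the same requirement on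
  the same numbers, for each \<open>P\<close> separately as well as uniformly.

  What remains is that the objects determine each other. For p-values \<open>E = 1 / Q\<close> works because
  reciprocals are involutive on \<open>[0, \<infinity>]\<close>. For random sets the candidate is the integrand of the
  risk, \<open>rejection_strength\<close>. When the rejected levels of \<open>\<theta>\<close> form \<open>[\<alpha>\<^sub>0, \<infinity>)\<close>, it equals
  \<open>1 / \<alpha>\<^sub>0\<close>, and the left endpoint being included is what makes \<open>\<theta> \<notin> H \<alpha>\<close> equivalent to
  \<open>1 / \<alpha> \<le> 1 / \<alpha>\<^sub>0\<close>. The same equivalence gives its measurability, although it is a supremum
  over uncountably many levels.
\<close>

section \<open>Levels and their reciprocals\<close>

lemma inverse_antimono_ennreal:
  fixes x y :: ennreal
  shows "x \<le> y \<Longrightarrow> inverse y \<le> inverse x"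
  by (cases "x = 0"; cases x; cases y) (auto simp: inverse_ennreal top_unique intro!: ennreal_leI)

lemma one_divide_le_one_divide_iff_ennreal:
  fixes x y :: ennreal
  shows "1 / x \<le> 1 / y \<longleftrightarrow> y \<le> x"
proof -
  have antimono: "1 / b \<le> 1 / a" if "a \<le> b" for a b :: ennreal
    using inverse_antimono_ennreal[OF that] by (simp add: divide_ennreal_def)
  show ?thesis
    using antimono[of y x] antimono[of "1 / x" "1 / y"] by auto
qed

text \<open>The upper bound is immediate. For the lower bound every finite nonzero \<open>c < x\<close> is the
  reciprocal of the admissible level \<open>1 / c\<close>, and such \<open>c\<close> are dense below \<open>x\<close>; arguing by density
  instead of inserting \<open>\<alpha> = 1 / x\<close> covers \<open>x = 0\<close> and \<open>x = \<infinity>\<close>, where \<open>1 / x\<close> is not a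
  positive real.\<close>

lemma SUP_reject_levels:
  fixes x :: ennreal
  shows "(SUP \<alpha>\<in>{0<..}. of_bool (1 / ennreal \<alpha> \<le> x) / ennreal \<alpha>) = x"
proof (rule antisym)
  show "(SUP \<alpha>\<in>{0<..}. of_bool (1 / ennreal \<alpha> \<le> x) / ennreal \<alpha>) \<le> x"
    by (rule SUP_least) simp
  show "x \<le> (SUP \<alpha>\<in>{0<..}. of_bool (1 / ennreal \<alpha> \<le> x) / ennreal \<alpha>)" (is "_ \<le> ?S")
  proof (rule dense_le)
    fix c assume "c < x"
    show "c \<le> ?S"
    proof (cases "c = 0")
      case False
      with \<open>c < x\<close> obtain r where r: "0 < r" "c = ennreal r"
        by (cases c) auto
      have c: "1 / ennreal (1 / r) = c"
        using r divide_ennreal[of 1 r] by (simp flip: divide_ennreal)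
      have "c = of_bool (1 / ennreal (1 / r) \<le> x) / ennreal (1 / r)"
        using \<open>c < x\<close> c by simp
      also have "\<dots> \<le> ?S"
        using r by (intro SUP_upper) auto
      finally show ?thesis .
    qed simp
  qed
qed

section \<open>The e-value of a family of random sets\<close>

definition rejection_strength :: "(real \<Rightarrow> 'a \<Rightarrow> 'b set) \<Rightarrow> 'b \<Rightarrow> 'a \<Rightarrow> ennreal" where
  "rejection_strength H \<theta> \<omega> = (SUP \<alpha>\<in>{0<..}. of_bool (\<theta> \<notin> H \<alpha> \<omega>) / ennreal \<alpha>)"

lemma confidence_risk_eq_nn_integral:
  "confidence_risk H \<theta>s P = (\<integral>\<^sup>+\<omega>. rejection_strength H (\<theta>s P) \<omega> \<partial>P)"
  by (simp add: confidence_risk_def rejection_strength_def)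

lemma rejection_strength_eqI:
  assumes "\<And>\<alpha>. 0 < \<alpha> \<Longrightarrow> \<theta> \<notin> H \<alpha> \<omega> \<longleftrightarrow> 1 / ennreal \<alpha> \<le> x"
  shows "rejection_strength H \<theta> \<omega> = x"
proof -
  have "rejection_strength H \<theta> \<omega> = (SUP \<alpha>\<in>{0<..}. of_bool (1 / ennreal \<alpha> \<le> x) / ennreal \<alpha>)"
    unfolding rejection_strength_def using assms by (intro SUP_cong) auto
  then show ?thesis by (simp add: SUP_reject_levels)
qed

lemma level_right_continuous_imp_reject_iff:
  assumes "level_right_continuous M \<Theta> H" "\<omega> \<in> space M" "\<theta> \<in> \<Theta>" "0 < \<alpha>"
  shows "\<theta> \<notin> H \<alpha> \<omega> \<longleftrightarrow> 1 / ennreal \<alpha> \<le> rejection_strength H \<theta> \<omega>"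
proof -
  obtain \<alpha>\<^sub>0 where \<alpha>\<^sub>0: "\<alpha>\<^sub>0 > 0" "{\<alpha>. 0 < \<alpha> \<and> \<theta> \<notin> H \<alpha> \<omega>} = {\<alpha>\<^sub>0..}"
    using assms unfolding level_right_continuous_def by blast
  have reject: "\<theta> \<notin> H \<beta> \<omega> \<longleftrightarrow> 1 / ennreal \<beta> \<le> 1 / ennreal \<alpha>\<^sub>0" if "0 < \<beta>" for \<beta>
  proof -
    have "\<theta> \<notin> H \<beta> \<omega> \<longleftrightarrow> \<beta> \<in> {\<alpha>\<^sub>0..}"
      using that \<alpha>\<^sub>0(2) by blast
    then show ?thesis
      using that by (simp add: one_divide_le_one_divide_iff_ennreal)
  qed
  show ?thesis
    using reject[OF \<open>0 < \<alpha>\<close>] rejection_strength_eqI[of \<theta> H \<omega>, OF reject] by simp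
qed

lemma rejection_strength_less_top:
  assumes "level_right_continuous M \<Theta> H" "\<omega> \<in> space M" "\<theta> \<in> \<Theta>"
  shows "rejection_strength H \<theta> \<omega> < top"
proof -
  obtain \<alpha>\<^sub>0 where \<alpha>\<^sub>0: "\<alpha>\<^sub>0 > 0" "{\<alpha>. 0 < \<alpha> \<and> \<theta> \<notin> H \<alpha> \<omega>} = {\<alpha>\<^sub>0..}"
    using assms unfolding level_right_continuous_def by blast
  have "\<alpha>\<^sub>0 / 2 \<notin> {\<alpha>. 0 < \<alpha> \<and> \<theta> \<notin> H \<alpha> \<omega>}"
    unfolding \<alpha>\<^sub>0(2) using \<alpha>\<^sub>0(1) by simp
  then have "rejection_strength H \<theta> \<omega> < 1 / ennreal (\<alpha>\<^sub>0 / 2)"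
    using \<alpha>\<^sub>0(1) level_right_continuous_imp_reject_iff[OF assms, of "\<alpha>\<^sub>0 / 2"] by (simp add: not_le)
  also have "\<dots> \<le> top" by simp
  finally show ?thesis .
qed

text \<open>The superlevel sets at finite nonzero heights \<open>1 / \<alpha>\<close> are the rejection events at the
  levels \<open>\<alpha>\<close>, hence measurable; the height \<open>0\<close> gives the whole space and the height \<open>\<infinity>\<close> the
  empty set, since the left endpoint of the rejected levels is positive.\<close>

lemma borel_measurable_rejection_strength:
  assumes subset: "\<And>\<alpha>. 0 < \<alpha> \<Longrightarrow> random_subset M \<Theta> (H \<alpha>)"
    and cont: "level_right_continuous M \<Theta> H" and \<theta>: "\<theta> \<in> \<Theta>"
  shows "rejection_strength H \<theta> \<in> borel_measurable M"
proof (rule borel_measurableI_ge)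
  fix c :: ennreal
  consider "c = 0" | "c = top" | \<alpha> where "0 < \<alpha>" "c = 1 / ennreal \<alpha>"
  proof (cases c)
    case (real r)
    then show thesis
      using that(1) that(3)[of "1 / r"] by (cases "r = 0") (simp_all add: divide_ennreal flip: ennreal_1)
  qed (use that(2) in simp)
  then show "{\<omega> \<in> space M. c \<le> rejection_strength H \<theta> \<omega>} \<in> sets M"
  proof cases
    case 2
    have "{\<omega> \<in> space M. c \<le> rejection_strength H \<theta> \<omega>} = {}"
      using 2 rejection_strength_less_top[OF cont _ \<theta>] by (fastforce simp: top_unique)
    then show ?thesis by (simp only: sets.empty_sets)
  next
    case (3 \<alpha>)
    have "{\<omega> \<in> space M. c \<le> rejection_strength H \<theta> \<omega>} = {\<omega> \<in> space M. \<theta> \<notin> H \<alpha> \<omega>}"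
      using 3 level_right_continuous_imp_reject_iff[OF cont _ \<theta>] by auto
    then show ?thesis
      using subset[OF 3(1)] \<theta> by (simp add: random_subset_def)
  qed simp
qed

lemma level_set_representation_rejection_strength:
  assumes "\<And>n \<alpha>. 1 \<le> n \<Longrightarrow> 0 < \<alpha> \<Longrightarrow> random_subset M \<Theta> (H n \<alpha>)"
    and "\<And>n. 1 \<le> n \<Longrightarrow> level_right_continuous M \<Theta> (H n)"
  shows "level_set_representation M \<Theta> H (\<lambda>n. rejection_strength (H n))"
  unfolding level_set_representation_def
proof (intro allI impI ballI)
  fix n :: nat and \<alpha> :: real and \<omega>
  assume n: "1 \<le> n" and \<alpha>: "0 < \<alpha>" and \<omega>: "\<omega> \<in> space M"
  have "H n \<alpha> \<omega> \<subseteq> \<Theta>"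
    using assms(1)[OF n \<alpha>] \<omega> by (auto simp: random_subset_def)
  then show "H n \<alpha> \<omega> = {\<theta> \<in> \<Theta>. rejection_strength (H n) \<theta> \<omega> < 1 / ennreal \<alpha>}"
    using level_right_continuous_imp_reject_iff[OF assms(2)[OF n] \<omega> _ \<alpha>]
    by (auto simp: not_le[symmetric])
qed

section \<open>Risks as expectations\<close>

text \<open>A representing \<open>E\<close> need not be built from \<open>H\<close> as above, but the identity for suprema
  of reciprocal levels leaves no choice: the level sets determine \<open>E\<close> on \<open>\<Theta>\<close>. This is why any
  representation, not only the canonical one, has the right expectation.\<close>

lemma confidence_risk_eq_nn_integral_e_value:
  assumes "level_set_representation M \<Theta> H E" "1 \<le> n"
    and "\<theta>s P \<in> \<Theta>" "sets P = sets M"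
  shows "confidence_risk (H n) \<theta>s P = (\<integral>\<^sup>+\<omega>. E n (\<theta>s P) \<omega> \<partial>P)"
  unfolding confidence_risk_eq_nn_integral
proof (rule nn_integral_cong)
  fix \<omega> assume "\<omega> \<in> space P"
  then have "\<omega> \<in> space M"
    using sets_eq_imp_space_eq[OF assms(4)] by simp
  then show "rejection_strength (H n) (\<theta>s P) \<omega> = E n (\<theta>s P) \<omega>"
    using assms(1-3) by (intro rejection_strength_eqI) (auto simp: level_set_representation_def)
qed

lemma p_value_risk_eq_nn_integral: "p_value_risk Q P = (\<integral>\<^sup>+\<omega>. 1 / Q \<omega> \<partial>P)"
proof -
  have "(SUP \<alpha>\<in>{0<..}. of_bool (Q \<omega> \<le> ennreal \<alpha>) / ennreal \<alpha>) = 1 / Q \<omega>" for \<omega>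
    using SUP_reject_levels[of "1 / Q \<omega>"] by (simp add: one_divide_le_one_divide_iff_ennreal)
  then show ?thesis by (simp add: p_value_risk_def)
qed

text \<open>The values at \<open>n = 0\<close> are arbitrary, so risks and expectations agree only eventually;
  limits superior do not see the difference.\<close>

lemma limsup_cong_ge_1:
  fixes f g :: "nat \<Rightarrow> ennreal"
  assumes "\<And>n. 1 \<le> n \<Longrightarrow> f n = g n"
  shows "limsup f = limsup g"
  using assms by (intro Limsup_eq eventually_sequentiallyI[of 1]) auto

lemma SUP_limsup_cong_ge_1:
  fixes f g :: "'p \<Rightarrow> nat \<Rightarrow> ennreal"
  assumes "\<And>P n. P \<in> \<P> \<Longrightarrow> 1 \<le> n \<Longrightarrow> f P n = g P n"
  shows "(SUP P\<in>\<P>. limsup (f P)) = (SUP P\<in>\<P>. limsup (g P))"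
    and "limsup (\<lambda>n. SUP P\<in>\<P>. f P n) = limsup (\<lambda>n. SUP P\<in>\<P>. g P n)"
  using assms by (auto intro!: SUP_cong limsup_cong_ge_1)

lemma post_hoc_ci_iff_e_variable_at:
  assumes "level_set_representation M \<Theta> H E"
    and "\<And>n \<theta>. 1 \<le> n \<Longrightarrow> \<theta> \<in> \<Theta> \<Longrightarrow> E n \<theta> \<in> borel_measurable M"
    and "\<And>P. P \<in> \<P> \<Longrightarrow> sets P = sets M" "\<And>P. P \<in> \<P> \<Longrightarrow> \<theta>s P \<in> \<Theta>"
  shows "asymp_post_hoc_ci \<P> \<theta>s H \<longleftrightarrow> asymp_e_variable_at M \<P> \<theta>s E"
    and "unif_asymp_post_hoc_ci \<P> \<theta>s H \<longleftrightarrow> unif_asymp_e_variable_at M \<P> \<theta>s E"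
proof -
  have risk: "confidence_risk (H n) \<theta>s P = (\<integral>\<^sup>+\<omega>. E n (\<theta>s P) \<omega> \<partial>P)"
    if "P \<in> \<P>" "1 \<le> n" for P n
    using assms that by (intro confidence_risk_eq_nn_integral_e_value)
  note eq = SUP_limsup_cong_ge_1[of \<P> "\<lambda>P n. confidence_risk (H n) \<theta>s P", OF risk]
  show "asymp_post_hoc_ci \<P> \<theta>s H \<longleftrightarrow> asymp_e_variable_at M \<P> \<theta>s E"
    using assms eq(1) by (simp add: asymp_post_hoc_ci_def asymp_e_variable_at_def)
  show "unif_asymp_post_hoc_ci \<P> \<theta>s H \<longleftrightarrow> unif_asymp_e_variable_at M \<P> \<theta>s E"
    using assms eq(2) by (simp add: unif_asymp_post_hoc_ci_def unif_asymp_e_variable_at_def)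
qed

lemma post_hoc_p_value_iff_e_variable:
  assumes Q: "\<And>n \<omega>. 1 \<le> n \<Longrightarrow> \<omega> \<in> space M \<Longrightarrow> Q n \<omega> = 1 / E n \<omega>"
    and E: "\<And>n. 1 \<le> n \<Longrightarrow> E n \<in> borel_measurable M"
    and \<P>: "\<And>P. P \<in> \<P> \<Longrightarrow> sets P = sets M"
  shows "asymp_post_hoc_p_value \<P> Q \<longleftrightarrow> asymp_e_variable M \<P> E"
    and "unif_asymp_post_hoc_p_value \<P> Q \<longleftrightarrow> unif_asymp_e_variable M \<P> E"
proof -
  have risk: "p_value_risk (Q n) P = (\<integral>\<^sup>+\<omega>. E n \<omega> \<partial>P)" if "P \<in> \<P>" "1 \<le> n" for P n
    unfolding p_value_risk_eq_nn_integral
    using that Q sets_eq_imp_space_eq[OF \<P>]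
    by (intro nn_integral_cong) simp
  note eq = SUP_limsup_cong_ge_1[of \<P> "\<lambda>P n. p_value_risk (Q n) P", OF risk]
  show "asymp_post_hoc_p_value \<P> Q \<longleftrightarrow> asymp_e_variable M \<P> E"
    using E eq(1) by (simp add: asymp_post_hoc_p_value_def asymp_e_variable_def)
  show "unif_asymp_post_hoc_p_value \<P> Q \<longleftrightarrow> unif_asymp_e_variable M \<P> E"
    using E eq(2) by (simp add: unif_asymp_post_hoc_p_value_def unif_asymp_e_variable_def)
qed

section \<open>Post-hoc inference and e-variables\<close>

theorem proposition2p6:
  fixes M :: "'a measure" and \<P> :: "'a measure set"
    and \<Theta> :: "'b set" and \<theta>s :: "'a measure \<Rightarrow> 'b"
  assumes "\<And>P. P \<in> \<P> \<Longrightarrow> prob_space P \<and> sets P = sets M"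
    and "\<And>P. P \<in> \<P> \<Longrightarrow> \<theta>s P \<in> \<Theta>"
  shows
    "(\<forall>H :: nat \<Rightarrow> real \<Rightarrow> 'a \<Rightarrow> 'b set.
        (\<forall>n\<ge>1. (\<forall>\<alpha>>0. random_subset M \<Theta> (H n \<alpha>)) \<and>
               level_monotonic M (H n) \<and> level_right_continuous M \<Theta> (H n)) \<longrightarrow>
        (asymp_post_hoc_ci \<P> \<theta>s H \<longleftrightarrow>
          (\<exists>E :: nat \<Rightarrow> 'b \<Rightarrow> 'a \<Rightarrow> ennreal.
             (\<forall>n\<ge>1. \<forall>\<theta>\<in>\<Theta>. E n \<theta> \<in> borel_measurable M) \<and>
             level_set_representation M \<Theta> H E \<and> asymp_e_variable_at M \<P> \<theta>s E)) \<and>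
        (unif_asymp_post_hoc_ci \<P> \<theta>s H \<longleftrightarrow>
          (\<exists>E :: nat \<Rightarrow> 'b \<Rightarrow> 'a \<Rightarrow> ennreal.
             (\<forall>n\<ge>1. \<forall>\<theta>\<in>\<Theta>. E n \<theta> \<in> borel_measurable M) \<and>
             level_set_representation M \<Theta> H E \<and> unif_asymp_e_variable_at M \<P> \<theta>s E))) \<and>
     (\<forall>Q :: nat \<Rightarrow> 'a \<Rightarrow> ennreal.
        (\<forall>n\<ge>1. Q n \<in> borel_measurable M) \<longrightarrow>
        (asymp_post_hoc_p_value \<P> Q \<longleftrightarrow>
          (\<exists>E. asymp_e_variable M \<P> E \<and> (\<forall>n\<ge>1. \<forall>\<omega>\<in>space M. Q n \<omega> = 1 / E n \<omega>))) \<and>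
        (unif_asymp_post_hoc_p_value \<P> Q \<longleftrightarrow>
          (\<exists>E. unif_asymp_e_variable M \<P> E \<and> (\<forall>n\<ge>1. \<forall>\<omega>\<in>space M. Q n \<omega> = 1 / E n \<omega>))))"
proof -
  have sets: "sets P = sets M" if "P \<in> \<P>" for P
    using assms(1)[OF that] by simp
  note ci_iff = post_hoc_ci_iff_e_variable_at[of M \<Theta> _ _ \<P> \<theta>s, OF _ _ sets assms(2)]
  note p_value_iff = post_hoc_p_value_iff_e_variable[of M _ _ \<P>, OF _ _ sets]
  show ?thesis
  proof (intro conjI[of "All _" "All _"] allI impI, goal_cases)
    case (1 H)
    let ?E = "\<lambda>n. rejection_strength (H n)"
    have meas: "?E n \<theta> \<in> borel_measurable M" if "1 \<le> n" "\<theta> \<in> \<Theta>" for n \<theta>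
      using 1 that by (intro borel_measurable_rejection_strength[of M \<Theta>]) auto
    have repr: "level_set_representation M \<Theta> H ?E"
      using 1 by (intro level_set_representation_rejection_strength) auto
    show ?case
    proof (intro conjI iffI; (elim exE conjE)?)
      assume "asymp_post_hoc_ci \<P> \<theta>s H"
      then have "asymp_e_variable_at M \<P> \<theta>s ?E"
        using ci_iff(1)[of H ?E] repr meas by simp
      then show "\<exists>E. (\<forall>n\<ge>1. \<forall>\<theta>\<in>\<Theta>. E n \<theta> \<in> borel_measurable M) \<and>
          level_set_representation M \<Theta> H E \<and> asymp_e_variable_at M \<P> \<theta>s E"
        using repr meas by (intro exI[of _ ?E]) simp
    next
      assume "unif_asymp_post_hoc_ci \<P> \<theta>s H"
      then have "unif_asymp_e_variable_at M \<P> \<theta>s ?E"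
        using ci_iff(2)[of H ?E] repr meas by simp
      then show "\<exists>E. (\<forall>n\<ge>1. \<forall>\<theta>\<in>\<Theta>. E n \<theta> \<in> borel_measurable M) \<and>
          level_set_representation M \<Theta> H E \<and> unif_asymp_e_variable_at M \<P> \<theta>s E"
        using repr meas by (intro exI[of _ ?E]) simp
    qed (simp_all add: ci_iff)
  next
    case (2 Q)
    let ?E = "\<lambda>n \<omega>. 1 / Q n \<omega>"
    have meas: "?E n \<in> borel_measurable M" if "1 \<le> n" for n
      using 2 that by (auto simp: divide_ennreal_def)
    have Q: "Q n \<omega> = 1 / ?E n \<omega>" for n \<omega>
      by simp
    have iff: "asymp_post_hoc_p_value \<P> Q \<longleftrightarrow> asymp_e_variable M \<P> ?E"
      "unif_asymp_post_hoc_p_value \<P> Q \<longleftrightarrow> unif_asymp_e_variable M \<P> ?E"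
      using p_value_iff[of Q ?E, OF Q meas] by blast+
    show ?case
    proof (intro conjI iffI; (elim exE conjE)?)
      show "\<exists>E. asymp_e_variable M \<P> E \<and> (\<forall>n\<ge>1. \<forall>\<omega>\<in>space M. Q n \<omega> = 1 / E n \<omega>)"
        if "asymp_post_hoc_p_value \<P> Q"
        using that iff Q by (intro exI[of _ ?E]) simp
      show "\<exists>E. unif_asymp_e_variable M \<P> E \<and> (\<forall>n\<ge>1. \<forall>\<omega>\<in>space M. Q n \<omega> = 1 / E n \<omega>)"
        if "unif_asymp_post_hoc_p_value \<P> Q"
        using that iff Q by (intro exI[of _ ?E]) simp
    next
      fix E assume E: "asymp_e_variable M \<P> E" "\<forall>n\<ge>1. \<forall>\<omega>\<in>space M. Q n \<omega> = 1 / E n \<omega>"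
      then show "asymp_post_hoc_p_value \<P> Q"
        using p_value_iff(1)[of Q E] by (auto simp: asymp_e_variable_def)
    next
      fix E assume E: "unif_asymp_e_variable M \<P> E" "\<forall>n\<ge>1. \<forall>\<omega>\<in>space M. Q n \<omega> = 1 / E n \<omega>"
      then show "unif_asymp_post_hoc_p_value \<P> Q"
        using p_value_iff(2)[of Q E] by (auto simp: unif_asymp_e_variable_def)
    qed
  qed
qed

end
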